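(* There exists a symmetric fractional hedonic game that admits no individually stable partition.
   Context: A fractional hedonic game (FHG) on agents $N$ is given by utility functions $v_i:N\to\mathbb R$ with $v_i(i)=0$; agent $i$'s utility for a coalition $C\ni i$ is $\frac{1}{|C|}\sum_{j\in C}v_i(j)$, and $i$ prefers coalitions with higher utility. The FHG is symmetric if $v_i(j)=v_j(i)$ for all $i,j$. An IS deviation of agent $i$ from partition $\pi$ to $\pi'$ is a move of $i$ alone from $\pi(i)$ into another coalition of $\pi$ or into a new singleton such that $i$ strictly prefers $\pi'(i)$ to $\pi(i)$ and every $j\in\pi'(i)\setminus\{i\}$ weakly prefers $\pi'(j)$ to $\pi(j)$. A partition is individually stable (IS) if no IS deviation is possible from it. *)

theory Defs
  imports Complex_Main "HOL-Library.Disjoint_Sets"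
begin

text \<open>Fractional hedonic games. Agents form a finite nonempty set N; the valuation
  v i j is the value agent i assigns to agent j (only values on N matter).\<close>

definition fhg :: "'a set \<Rightarrow> ('a \<Rightarrow> 'a \<Rightarrow> real) \<Rightarrow> bool" where
  "fhg N v \<longleftrightarrow> finite N \<and> N \<noteq> {} \<and> (\<forall>i\<in>N. v i i = 0)"

definition symmetric_fhg :: "'a set \<Rightarrow> ('a \<Rightarrow> 'a \<Rightarrow> real) \<Rightarrow> bool" where
  "symmetric_fhg N v \<longleftrightarrow> fhg N v \<and> (\<forall>i\<in>N. \<forall>j\<in>N. v i j = v j i)"

definition fhg_util :: "('a \<Rightarrow> 'a \<Rightarrow> real) \<Rightarrow> 'a \<Rightarrow> 'a set \<Rightarrow> real" where
  "fhg_util v i C = (\<Sum>j\<in>C. v i j) / real (card C)"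

definition coal :: "'a set set \<Rightarrow> 'a \<Rightarrow> 'a set" where
  "coal \<pi> i = (THE C. C \<in> \<pi> \<and> i \<in> C)"

text \<open>An IS deviation of agent i from partition pi: i leaves its coalition and joins
  D, which is either another coalition of pi or the empty set (forming a new singleton).
  The new coalition of i is D with i inserted; i strictly improves and every member of
  D weakly improves (their coalition changes from D to D with i inserted).\<close>
definition IS_deviation :: "('a \<Rightarrow> 'a \<Rightarrow> real) \<Rightarrow> 'a set set \<Rightarrow> 'a \<Rightarrow> 'a set \<Rightarrow> bool" where
  "IS_deviation v \<pi> i D \<longleftrightarrow>
     (D \<in> \<pi> \<and> D \<noteq> coal \<pi> i \<or> D = {}) \<and>
     fhg_util v i (insert i D) > fhg_util v i (coal \<pi> i) \<and>
     (\<forall>j\<in>D. fhg_util v j (insert i D) \<ge> fhg_util v j D)"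

definition individually_stable :: "'a set \<Rightarrow> ('a \<Rightarrow> 'a \<Rightarrow> real) \<Rightarrow> 'a set set \<Rightarrow> bool" where
  "individually_stable N v \<pi> \<longleftrightarrow>
     partition_on N \<pi> \<and> \<not> (\<exists>i\<in>N. \<exists>D. IS_deviation v \<pi> i D)"

end

theory Submission
  imports Defs
begin

text \<open>
  The game lives on the 5-cycle with every vertex doubled: group i consists of
  a = 2 i and b = 2 i + 1, two agents are friends iff their groups are equal or adjacent,
  and the value of enemies is so low that in a stable partition all coalitions are cliques
  of friends, hence subsets of a block formed by two adjacent groups. If a coalition
  were a nonempty proper subset of a block, then some agent outside it would be
  stranded: every clique containing this agent that is disjoint from the coalition exchanges
  a deviating agent with it, in one direction or the other. So all coalitions are full
  blocks of size 4, which is impossible for 10 agents.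
\<close>

definition agents :: "nat set" where
  "agents = {0..<10}"

text \<open>
  Friends within a group have value 4. Agents of group i value a of group i + 1 at 5;
  b of group i + 1 has value 4 to a and value 3 to b of group i.
\<close>

definition weight :: "nat \<Rightarrow> nat \<Rightarrow> int" where
  "weight x y =
     [[0, 4, 5, 4, -100, -100, -100, -100, 5, 5],
      [4, 0, 5, 3, -100, -100, -100, -100, 4, 3],
      [5, 5, 0, 4, 5, 4, -100, -100, -100, -100],
      [4, 3, 4, 0, 5, 3, -100, -100, -100, -100],
      [-100, -100, 5, 5, 0, 4, 5, 4, -100, -100],
      [-100, -100, 4, 3, 4, 0, 5, 3, -100, -100],
      [-100, -100, -100, -100, 5, 5, 0, 4, 5, 4],
      [-100, -100, -100, -100, 4, 3, 4, 0, 5, 3],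
      [5, 4, -100, -100, -100, -100, 5, 5, 0, 4],
      [5, 3, -100, -100, -100, -100, 4, 3, 4, 0]] ! x ! y"

text \<open>Integer weights keep the finite checks below executable; the game itself needs real
  values.\<close>

definition valuation :: "nat \<Rightarrow> nat \<Rightarrow> real" where
  "valuation x y = of_int (weight x y)"

definition blocks :: "nat list list" where
  "blocks = [[0, 1, 2, 3], [2, 3, 4, 5], [4, 5, 6, 7], [6, 7, 8, 9], [8, 9, 0, 1]]"

definition total :: "nat \<Rightarrow> nat list \<Rightarrow> int" where
  "total x C = sum_list (map (weight x) C)"

text \<open>
  Utility comparisons with denominators cleared; the second conjunct says that adding x
  does not decrease the average of y.
\<close>

definition moves :: "nat list \<Rightarrow> nat list \<Rightarrow> bool" where
  "moves C D \<longleftrightarrow>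
     (\<exists>x\<in>set C. total x C * int (Suc (length D)) < total x D * int (length C) \<and>
               (\<forall>y\<in>set D. total y D \<le> weight y x * int (length D)))"

text \<open>\<open>D\<close> runs over all candidates for the coalition of \<open>x\<close>,
  including \<open>[x]\<close>. Those meeting \<open>C\<close> are excused, since they cannot occur
  beside \<open>C\<close> in a partition.\<close>

definition strands :: "nat list \<Rightarrow> nat \<Rightarrow> bool" where
  "strands C x \<longleftrightarrow>
     x \<notin> set C \<and>
     (\<forall>B\<in>set blocks. x \<in> set B \<longrightarrow>
       (\<forall>D\<in>set (subseqs B). x \<in> set D \<longrightarrow>
          set C \<inter> set D \<noteq> {} \<or> moves C D \<or> moves D C))"

lemma weight_facts:
  "\<forall>x\<in>{0..<10}. weight x x = 0 \<and>
     (\<forall>y\<in>{0..<10}. weight x y = weight y x \<and> weight x y \<le> 5 \<and> (weight x y < 0 \<longrightarrow> weight x y = -100))"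
  by code_simp

lemma weight_self [simp]: "x \<in> agents \<Longrightarrow> weight x x = 0"
  and weight_commute: "\<lbrakk>x \<in> agents; y \<in> agents\<rbrakk> \<Longrightarrow> weight x y = weight y x"
  and weight_le: "\<lbrakk>x \<in> agents; y \<in> agents\<rbrakk> \<Longrightarrow> weight x y \<le> 5"
  and weight_negD: "\<lbrakk>x \<in> agents; y \<in> agents; weight x y < 0\<rbrakk> \<Longrightarrow> weight x y = -100"
  using weight_facts by (auto simp: agents_def)

text \<open>A finite evaluation: five blocks, 16 sublists each, and \<open>moves\<close> only
  compares integers.\<close>

lemma proper_sublist_strands:
  "\<forall>B\<in>set blocks. \<forall>C\<in>set (subseqs B). C = [] \<or> C = B \<or> (\<exists>x\<in>{0..<10}. strands C x)"
  by code_simp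

lemma fhg_util_set:
  assumes "distinct C"
  shows "fhg_util valuation x (set C) = of_int (total x C) / real (length C)"
  using assms
  by (simp add: fhg_util_def valuation_def total_def distinct_card sum_list_distinct_conv_sum_set)

lemma fhg_util_insert:
  assumes "distinct D" "x \<notin> set D"
  shows "fhg_util valuation y (insert x (set D)) = of_int (total y D + weight y x) / real (Suc (length D))"
  using fhg_util_set[of "x # D" y] assms by (simp add: total_def add.commute)

lemma coal_eq:
  assumes "partition_on N \<pi>" "C \<in> \<pi>" "x \<in> C"
  shows "coal \<pi> x = C"
  unfolding coal_def by (rule the_equality) (use assms in \<open>auto simp: partition_on_def disjoint_def\<close>)

lemma moves_imp_unstable:
  assumes part: "partition_on agents \<pi>"
    and C: "set C \<in> \<pi>" "distinct C" and D: "set D \<in> \<pi>" "distinct D"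
    and "set C \<noteq> set D" "moves C D"
  shows "\<not> individually_stable agents valuation \<pi>"
proof -
  obtain x where x: "x \<in> set C"
    and gain: "total x C * int (Suc (length D)) < total x D * int (length C)"
    and accept: "\<And>y. y \<in> set D \<Longrightarrow> total y D \<le> weight y x * int (length D)"
    using \<open>moves C D\<close> unfolding moves_def by blast
  have xD: "x \<notin> set D" and xN: "x \<in> agents"
    using part C D x \<open>set C \<noteq> set D\<close> by (auto simp: partition_on_def disjoint_def)
  have "length C > 0" using x by (cases C) auto
  moreover have "real_of_int (total x C) * real (Suc (length D)) < real_of_int (total x D) * real (length C)"
    using gain by (metis of_int_less_iff of_int_mult of_int_of_nat_eq)
  \<comment> \<open>As \<open>weight x x = 0\<close>, \<open>total x D\<close> is also the sum for
    \<open>x\<close> over the enlarged coalition, whose size is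
    \<open>Suc (length D)\<close>.\<close>
  ultimately have improve:
    "fhg_util valuation x (coal \<pi> x) < fhg_util valuation x (insert x (set D))"
    using xN xD D C by (simp add: coal_eq[OF part C(1) x] fhg_util_set fhg_util_insert field_simps)
  have "fhg_util valuation y (set D) \<le> fhg_util valuation y (insert x (set D))" if y: "y \<in> set D" for y
  proof -
    have "length D > 0" using y by (cases D) auto
    moreover have "real_of_int (total y D) \<le> real_of_int (weight y x) * real (length D)"
      using accept[OF y] by (metis of_int_le_iff of_int_mult of_int_of_nat_eq)
    ultimately show ?thesis
      using xD D by (simp add: fhg_util_set fhg_util_insert field_simps)
  qed
  then have "IS_deviation valuation \<pi> x (set D)"
    using improve D \<open>set C \<noteq> set D\<close> by (auto simp: IS_deviation_def coal_eq[OF part C(1) x])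
  then show ?thesis using xN by (auto simp: individually_stable_def)
qed

text \<open>One enemy costs 100, while the remaining members, at most 10 worth at most 5 each, give
  back at most 50. So the utility is negative and being alone is better.\<close>

lemma individually_stable_weight_nonneg:
  assumes stable: "individually_stable agents valuation \<pi>"
    and C: "C \<in> \<pi>" "x \<in> C" "y \<in> C"
  shows "weight x y \<ge> 0"
proof (rule ccontr)
  assume neg: "\<not> weight x y \<ge> 0"
  have part: "partition_on agents \<pi>" using stable by (simp add: individually_stable_def)
  then have sub: "C \<subseteq> agents" using C by (auto simp: partition_on_def)
  have fin: "finite C" using sub finite_subset by (auto simp: agents_def)
  have "(\<Sum>z\<in>C. weight x z) = weight x y + (\<Sum>z\<in>C - {y}. weight x z)"
    using fin C(3) by (rule sum.remove)
  also have "\<dots> \<le> -100 + int (card (C - {y})) * 5"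
  proof (rule add_mono)
    show "weight x y \<le> -100" using weight_negD[of x y] neg subsetD[OF sub C(2)] subsetD[OF sub C(3)] by simp
    show "(\<Sum>z\<in>C - {y}. weight x z) \<le> int (card (C - {y})) * 5"
      using sub C by (intro sum_bounded_above weight_le) auto
  qed
  also have "\<dots> < 0"
    using card_mono[of "{0..<10::nat}" "C - {y}"] sub by (force simp: agents_def)
  finally have "(\<Sum>z\<in>C. weight x z) < 0" .
  then have "(\<Sum>z\<in>C. valuation x z) < 0"
    by (simp add: valuation_def flip: of_int_sum)
  moreover have "card C > 0" using fin C by (auto simp: card_gt_0_iff)
  ultimately have "fhg_util valuation x C < 0"
    by (simp add: fhg_util_def divide_neg_pos)
  \<comment> \<open>Nobody in the empty target can object, and the utility of the singleton is
    0.\<close>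
  then have "IS_deviation valuation \<pi> x {}"
    using sub C by (auto simp: IS_deviation_def coal_eq[OF part C(1,2)] fhg_util_def valuation_def)
  then show False using stable sub C by (auto simp: individually_stable_def)
qed

text \<open>Since a 5-cycle has no triangle, friends from two different groups have all common
  friends within these groups. Friends of a single group spread over three groups, hence the extra
  condition when the groups of \<open>x\<close> and \<open>y\<close> agree.\<close>

lemma common_friends_in_block:
  "\<forall>x\<in>{0..<10}. \<forall>y\<in>{0..<10}. weight x y \<ge> 0 \<longrightarrow>
     (\<exists>B\<in>set blocks. \<forall>z\<in>{0..<10}. weight x z \<ge> 0 \<and> weight y z \<ge> 0 \<and>
        (x div 2 = y div 2 \<longrightarrow> z div 2 = x div 2) \<longrightarrow> z \<in> set B)"
  by code_simp

lemma clique_subset_block: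
  assumes "C \<subseteq> agents" "C \<noteq> {}" and clique: "\<And>x y. \<lbrakk>x \<in> C; y \<in> C\<rbrakk> \<Longrightarrow> weight x y \<ge> 0"
  shows "\<exists>B\<in>set blocks. C \<subseteq> set B"
proof -
  \<comment> \<open>Take members of different groups if there are any; otherwise \<open>C\<close>
    lies in one group and \<open>x = y\<close> will do.\<close>
  obtain x y where xy: "x \<in> C" "y \<in> C"
    and same: "x div 2 = y div 2 \<Longrightarrow> \<forall>z\<in>C. z div 2 = x div 2"
  proof (cases "\<exists>x\<in>C. \<exists>y\<in>C. x div 2 \<noteq> y div 2")
    case True
    then show ?thesis using that by blast
  next
    case False
    moreover obtain x where "x \<in> C" using \<open>C \<noteq> {}\<close> by blast
    ultimately show ?thesis using that[of x x] by blast
  qed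
  then have "x \<in> {0..<10}" "y \<in> {0..<10}" using assms(1) by (auto simp: agents_def)
  then obtain B where "B \<in> set blocks" and
    B: "\<forall>z\<in>{0..<10}. weight x z \<ge> 0 \<and> weight y z \<ge> 0 \<and>
        (x div 2 = y div 2 \<longrightarrow> z div 2 = x div 2) \<longrightarrow> z \<in> set B"
    using common_friends_in_block clique[OF xy] by blast
  moreover have "C \<subseteq> set B"
  proof
    fix z assume "z \<in> C"
    then have "weight x z \<ge> 0" "weight y z \<ge> 0" "z \<in> {0..<10}"
      using clique xy assms(1) by (auto simp: agents_def)
    then show "z \<in> set B" using B same \<open>z \<in> C\<close> by blast
  qed
  ultimately show ?thesis by blast
qed

lemma block_properties: "B \<in> set blocks \<Longrightarrow> distinct B \<and> length B = 4"
  by (auto simp: blocks_def)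

text \<open>Passes from sets to the lists over which the evaluated checks quantify.\<close>

lemma stable_coalition_sublist:
  assumes stable: "individually_stable agents valuation \<pi>" and "C \<in> \<pi>"
  obtains B xs where "B \<in> set blocks" "xs \<in> set (subseqs B)" "distinct xs" "C = set xs"
proof -
  have "C \<subseteq> agents" "C \<noteq> {}"
    using stable \<open>C \<in> \<pi>\<close> by (auto simp: individually_stable_def partition_on_def)
  then obtain B where B: "B \<in> set blocks" "C \<subseteq> set B"
    using clique_subset_block individually_stable_weight_nonneg[OF stable \<open>C \<in> \<pi>\<close>] by blast
  then have "C \<in> set ` set (subseqs B)" by (simp add: subseqs_powset)
  then obtain xs where "xs \<in> set (subseqs B)" "C = set xs" by blast
  moreover have "distinct xs"
    using subseqs_distinctD[OF \<open>xs \<in> set (subseqs B)\<close>] block_properties[OF B(1)] by blast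
  ultimately show ?thesis using that B by blast
qed

lemma stable_coalition_card:
  assumes stable: "individually_stable agents valuation \<pi>" and "C \<in> \<pi>"
  shows "card C = 4"
proof -
  have part: "partition_on agents \<pi>" using stable by (simp add: individually_stable_def)
  obtain B xs where B: "B \<in> set blocks" and xs: "xs \<in> set (subseqs B)" "distinct xs" "C = set xs"
    using stable_coalition_sublist[OF assms] .
  have "xs \<noteq> []" using part \<open>C \<in> \<pi>\<close> xs by (auto simp: partition_on_def)
  \<comment> \<open>The coalition \<open>D\<close> of a stranded \<open>x\<close> is itself a
    sublist of a block and disjoint from \<open>C\<close>, so \<open>strands\<close> provides a
    deviation between the two.\<close>
  moreover have False if x: "x \<in> {0..<10}" "strands xs x" for x
  proof -
    have "x \<in> \<Union>\<pi>" using part x(1) by (simp add: partition_on_def agents_def)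
    then obtain D where D: "D \<in> \<pi>" "x \<in> D" by blast
    obtain B' ys where B': "B' \<in> set blocks" and ys: "ys \<in> set (subseqs B')" "distinct ys" "D = set ys"
      using stable_coalition_sublist[OF stable \<open>D \<in> \<pi>\<close>] .
    have "x \<in> set B'" using ys D subseqs_powset[of B'] by blast
    then have "set xs \<inter> set ys \<noteq> {} \<or> moves xs ys \<or> moves ys xs"
      using x B' ys D by (auto simp: strands_def)
    moreover have "C \<noteq> D" using x D xs by (auto simp: strands_def)
    moreover have "C \<inter> D = {}"
      using part \<open>C \<noteq> D\<close> \<open>C \<in> \<pi>\<close> D by (auto simp: partition_on_def disjoint_def)
    ultimately show False
      using moves_imp_unstable[OF part, of xs ys] moves_imp_unstable[OF part, of ys xs]
        stable xs ys \<open>C \<in> \<pi>\<close> D by auto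
  qed
  ultimately have "xs = B" using proper_sublist_strands B xs by blast
  then show ?thesis using xs block_properties[OF B] by (simp add: distinct_card)
qed

theorem theorem5p1:
  shows "\<exists>(N :: nat set) (v :: nat \<Rightarrow> nat \<Rightarrow> real).
           symmetric_fhg N v \<and> \<not> (\<exists>\<pi>. individually_stable N v \<pi>)"
proof (intro exI conjI notI)
  show "symmetric_fhg agents valuation"
    using weight_self weight_commute
    by (auto simp: symmetric_fhg_def fhg_def valuation_def agents_def)
next
  assume "\<exists>\<pi>. individually_stable agents valuation \<pi>"
  then obtain \<pi> where stable: "individually_stable agents valuation \<pi>" ..
  then have part: "partition_on agents \<pi>" by (simp add: individually_stable_def)
  have fin: "finite agents" by (simp add: agents_def)
  have "4 * card \<pi> = card (\<Union>\<pi>)"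
  proof (rule card_partition)
    show "finite \<pi>" using finite_elements[OF fin part] .
    show "finite (\<Union>\<pi>)" using part fin by (auto simp: partition_on_def)
    show "card C = 4" if "C \<in> \<pi>" for C using stable_coalition_card[OF stable that] .
    show "C \<inter> D = {}" if "C \<in> \<pi>" "D \<in> \<pi>" "C \<noteq> D" for C D
      using part that by (auto simp: partition_on_def disjoint_def)
  qed
  then have "4 * card \<pi> = 10" using part by (simp add: partition_on_def agents_def)
  \<comment> \<open>10 is not a multiple of 4.\<close>
  then show False by presburger
qed

end
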